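(* Let $n\ge 1$, let $U,V\subseteq\mathbb{R}^{n+1}$ be open sets with coordinates $(t,x_1,\dots,x_n)$ and $(T,X_1,\dots,X_n)$ respectively, and consider the systems $$\frac{dx_i}{dt}=f_i(x_1,\dots,x_n)\quad(i=1,\dots,n)\ \text{ on } U,\qquad \frac{dX_i}{dT}=F_i(X_1,\dots,X_n)\quad(i=1,\dots,n)\ \text{ on } V,$$ with all $f_i$, $F_i$ smooth and nowhere zero. Let $\omega=(\omega^0,\dots,\omega^n)^t$ and $\Omega=(\Omega^0,\dots,\Omega^n)^t$ be the coframes $$\omega^0=dt,\quad \omega^i=\frac{dx_i}{f_i},\qquad \Omega^0=dT,\quad \Omega^i=\frac{dX_i}{F_i}\qquad(i=1,\dots,n)$$ on $U$ and $V$, and let $G=\{a\,I_{n+1}\mid a\in\mathbb{R}\setminus\{0\}\}$. Then the web equivalence problem for such systems is equivalent to the $G$-equivalence problem for these coframes: a diffeomorphism $\Phi:U\to V$ is a web equivalence from the first system to the second if and only if there is a smooth function $g:U\to G$ with $\Phi^*\Omega=g\,\omega$.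
   Context: The functions $f_i$ are smooth functions of $(x_1,\dots,x_n)$ only (defined on the projection of $U$ to $\mathbb{R}^n$), and likewise $F_i$ depends on $(X_1,\dots,X_n)$ only. A diffeomorphism $\Phi:U\to V$ is a web transformation if near each point of $U$ it has the form $\Phi(t,x_1,\dots,x_n)=(\varphi_0(t),\varphi_1(x_1),\dots,\varphi_n(x_n))$ for smooth one-variable functions $\varphi_0,\dots,\varphi_n$ (equivalently, its Jacobian matrix is diagonal at each point). A diffeomorphism $\Phi:U\to V$ maps the first system to the second (maps integral curves to integral curves) if there is a smooth function $[a_{ij}]:U\to \mathrm{GL}(n,\mathbb{R})$ with $\Phi^*(dX_i-F_i\,dT)=\sum_{j=1}^n a_{ij}(dx_j-f_j\,dt)$ for $i=1,\dots,n$. A web equivalence from the first system to the second is a web transformation $\Phi:U\to V$ that maps the first system to the second. $I_{n+1}$ is the $(n+1)\times(n+1)$ identity matrix. *)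

theory Defs
  imports "HOL-Analysis.Analysis"
begin

text \<open>
  The space with coordinates \<open>(t, x_1, ..., x_n)\<close> is \<open>real ^ 'n option\<close>: the coordinate \<open>t\<close> has
  index \<open>None\<close> and \<open>x_i\<close> has index \<open>Some i\<close>, where \<open>n = CARD('n)\<close>.
\<close>

definition space_proj :: "real ^ 'n option \<Rightarrow> real ^ 'n"
  where "space_proj p = (\<chi> i. p $ Some i)"

text \<open>
  The two predicates below are meant for open sets \<open>S\<close>. On an open subset of a Euclidean space,
  \<open>Ck_on k S f\<close> says that \<open>f\<close> is \<open>k\<close> times continuously differentiable, by recursion on its
  directional derivatives.
\<close>

primrec Ck_on :: "nat \<Rightarrow> 'a::real_normed_vector set \<Rightarrow> ('a \<Rightarrow> 'b::real_normed_vector) \<Rightarrow> bool"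
  where
    "Ck_on 0 S f \<longleftrightarrow> continuous_on S f"
  | "Ck_on (Suc k) S f \<longleftrightarrow>
       (\<forall>x\<in>S. f differentiable (at x)) \<and> (\<forall>v. Ck_on k S (\<lambda>x. frechet_derivative f (at x) v))"

definition smooth_on :: "'a::real_normed_vector set \<Rightarrow> ('a \<Rightarrow> 'b::real_normed_vector) \<Rightarrow> bool"
  where "smooth_on S f \<longleftrightarrow> (\<forall>k. Ck_on k S f)"

definition diffeomorphism ::
    "'a::real_normed_vector set \<Rightarrow> 'b::real_normed_vector set \<Rightarrow> ('a \<Rightarrow> 'b) \<Rightarrow> bool"
  where "diffeomorphism U V \<Phi> \<longleftrightarrow>
    bij_betw \<Phi> U V \<and> smooth_on U \<Phi> \<and> smooth_on V (inv_into U \<Phi>)"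

text \<open>
  A column of 1-forms is a 1-form with values in \<open>real ^ 'm\<close>, represented as a function of the base
  point and a tangent vector at that point.
\<close>

type_synonym ('a, 'm) form_column = "'a \<Rightarrow> 'a \<Rightarrow> real ^ 'm"

definition pullback ::
    "('a::real_normed_vector \<Rightarrow> 'b::real_normed_vector) \<Rightarrow> ('b, 'm) form_column \<Rightarrow> ('a, 'm) form_column"
  where "pullback \<Phi> \<alpha> p v = \<alpha> (\<Phi> p) (frechet_derivative \<Phi> (at p) v)"

definition coord_differential :: "'m \<Rightarrow> real ^ 'm \<Rightarrow> real ^ 'm \<Rightarrow> real"
  where "coord_differential k p v = v $ k"

definition system_forms :: "('n \<Rightarrow> real ^ 'n \<Rightarrow> real) \<Rightarrow> (real ^ 'n option, 'n) form_column"
  where "system_forms f p v =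
    (\<chi> i. coord_differential (Some i) p v - f i (space_proj p) * coord_differential None p v)"

definition system_coframe ::
    "('n \<Rightarrow> real ^ 'n \<Rightarrow> real) \<Rightarrow> (real ^ 'n option, 'n option) form_column"
  where "system_coframe f p v =
    (\<chi> k. case k of
        None \<Rightarrow> coord_differential None p v
      | Some i \<Rightarrow> coord_differential (Some i) p v / f i (space_proj p))"

definition web_transformation ::
    "(real ^ ('n::finite) option) set \<Rightarrow> (real ^ 'n option) set \<Rightarrow> (real ^ 'n option \<Rightarrow> real ^ 'n option) \<Rightarrow> bool"
  where "web_transformation U V \<Phi> \<longleftrightarrow>
    diffeomorphism U V \<Phi> \<and>
    (\<forall>p\<in>U. \<exists>N (\<phi> :: 'n option \<Rightarrow> real \<Rightarrow> real).
       open N \<and> p \<in> N \<and> N \<subseteq> U \<and>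
       (\<forall>k. smooth_on ((\<lambda>q. q $ k) ` N) (\<phi> k)) \<and>
       (\<forall>q\<in>N. \<Phi> q = (\<chi> k. \<phi> k (q $ k))))"

definition maps_system ::
    "(real ^ ('n::finite) option) set \<Rightarrow> ('n \<Rightarrow> real ^ 'n \<Rightarrow> real) \<Rightarrow>
     (real ^ 'n option) set \<Rightarrow> ('n \<Rightarrow> real ^ 'n \<Rightarrow> real) \<Rightarrow>
     (real ^ 'n option \<Rightarrow> real ^ 'n option) \<Rightarrow> bool"
  where "maps_system U f V F \<Phi> \<longleftrightarrow>
    diffeomorphism U V \<Phi> \<and>
    (\<exists>A :: real ^ 'n option \<Rightarrow> real ^ 'n ^ 'n.
       smooth_on U A \<and> (\<forall>p\<in>U. invertible (A p)) \<and>
       (\<forall>p\<in>U. \<forall>v. pullback \<Phi> (system_forms F) p v = A p *v system_forms f p v))"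

definition web_equivalence ::
    "(real ^ ('n::finite) option) set \<Rightarrow> ('n \<Rightarrow> real ^ 'n \<Rightarrow> real) \<Rightarrow>
     (real ^ 'n option) set \<Rightarrow> ('n \<Rightarrow> real ^ 'n \<Rightarrow> real) \<Rightarrow>
     (real ^ 'n option \<Rightarrow> real ^ 'n option) \<Rightarrow> bool"
  where "web_equivalence U f V F \<Phi> \<longleftrightarrow> web_transformation U V \<Phi> \<and> maps_system U f V F \<Phi>"

definition scalar_matrices :: "(real ^ 'm ^ 'm) set"
  where "scalar_matrices = {a *\<^sub>R mat 1 | a :: real. a \<noteq> 0}"

end

theory Submission
  imports Defs
begin

text \<open>
  Web transformations are the diffeomorphisms whose derivative is diagonal at every point
  (lemma \<open>web_transformation_iff_diagonal\<close>): a diagonal derivative forces each component of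
  \<open>\<Phi>\<close> to be constant, on a box, in all variables but one. Both sides of the
  theorem make the derivative diagonal, so that the theorem becomes an algebraic statement at each
  point. Let the derivative at \<open>p\<close> be diagonal with entries \<open>c_0, ..., c_n\<close>. Testing
  \<open>\<Phi>^*(dX_i - F_i dT) = \<Sum>_j a_ij (dx_j - f_j dt)\<close> on the coordinate vectors shows that
  it holds exactly when the matrix \<open>(a_ij)\<close> is diagonal with entries \<open>c_1, ..., c_n\<close> and
  \<open>c_i f_i = c_0 F_i\<close> for all \<open>i\<close>; the latter equations say that
  \<open>\<Phi>^*\<Omega> = c_0 \<omega>\<close>. As \<open>f_i\<close> and \<open>F_i\<close> have no zeros, they also
  show that \<open>c_0 \<noteq> 0\<close> if and only if the \<open>c_i\<close> are nonzero.

  The unknown multipliers on the two sides thus are \<open>diag (c_1, ..., c_n)\<close> and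
  \<open>c_0 I\<close>. The \<open>c_k\<close> are components of directional derivatives of \<open>\<Phi>\<close> along
  constant vectors, and so they are smooth without appeal to a chain rule for higher derivatives.
\<close>

section \<open>Smooth functions\<close>

lemma Ck_on_subset: "Ck_on k S f \<Longrightarrow> T \<subseteq> S \<Longrightarrow> Ck_on k T f"
  by (induction k arbitrary: f) (auto intro: continuous_on_subset)

text \<open>Openness matters here, since \<open>Ck_on\<close> refers to derivatives in the whole space.\<close>

lemma Ck_on_cong:
  assumes "open S" and "\<And>x. x \<in> S \<Longrightarrow> f x = g x" and "Ck_on k S f"
  shows "Ck_on k S g"
  using assms(2,3)
proof (induction k arbitrary: f g)
  case 0
  then show ?case using continuous_on_cong[of S S f g] by auto
next
  case (Suc k)
  have der: "(g has_derivative frechet_derivative f (at x)) (at x)" if "x \<in> S" for x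
    using Suc.prems that assms(1) frechet_derivative_works
    by (metis Ck_on.simps(2) has_derivative_transform_within_open)
  have eq: "frechet_derivative f (at x) = frechet_derivative g (at x)" if "x \<in> S" for x
    using frechet_derivative_at[OF der[OF that]] .
  have "Ck_on k S (\<lambda>x. frechet_derivative g (at x) v)" for v
    by (rule Suc.IH[where f = "\<lambda>x. frechet_derivative f (at x) v"])
      (use Suc.prems eq in auto)
  moreover have "\<forall>x\<in>S. g differentiable (at x)"
    using der by (auto simp: differentiable_def)
  ultimately show ?case by simp
qed

lemma Ck_on_const: "Ck_on k S (\<lambda>x. c)"
  by (induction k arbitrary: c) (auto simp: frechet_derivative_const)

lemma Ck_on_add:
  assumes "open S" and "Ck_on k S f" and "Ck_on k S g"
  shows "Ck_on k S (\<lambda>x. f x + g x)"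
  using assms(2,3)
proof (induction k arbitrary: f g)
  case 0
  then show ?case by (auto intro: continuous_on_add)
next
  case (Suc k)
  have der: "((\<lambda>x. f x + g x) has_derivative
      (\<lambda>v. frechet_derivative f (at x) v + frechet_derivative g (at x) v)) (at x)"
    if "x \<in> S" for x
    using Suc.prems that frechet_derivative_works by (auto intro!: has_derivative_add)
  have "Ck_on k S (\<lambda>x. frechet_derivative (\<lambda>x. f x + g x) (at x) v)" for v
    by (rule Ck_on_cong[OF assms(1) _ Suc.IH[of "\<lambda>x. frechet_derivative f (at x) v"
            "\<lambda>x. frechet_derivative g (at x) v"]])
      (use Suc.prems frechet_derivative_at[OF der] in \<open>auto simp: fun_eq_iff\<close>)
  then show ?case using der by (auto simp: differentiable_def)
qed

lemma Ck_on_sum: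
  assumes "open S" and "finite I" and "\<And>i. i \<in> I \<Longrightarrow> Ck_on k S (f i)"
  shows "Ck_on k S (\<lambda>x. \<Sum>i\<in>I. f i x)"
  using assms(2,3)
  by (induction I rule: finite_induct) (auto intro: Ck_on_const Ck_on_add[OF assms(1)])

lemma Ck_on_linear_comp:
  assumes "open S" and L: "bounded_linear L" and "Ck_on k S f"
  shows "Ck_on k S (\<lambda>x. L (f x))"
  using assms(3)
proof (induction k arbitrary: f)
  case 0
  then show ?case
    by (auto intro: bounded_linear.continuous_on[OF L])
next
  case (Suc k)
  have der: "((\<lambda>x. L (f x)) has_derivative (\<lambda>v. L (frechet_derivative f (at x) v))) (at x)"
    if "x \<in> S" for x
    using Suc.prems that frechet_derivative_works
    by (auto intro!: bounded_linear.has_derivative[OF L])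
  have "Ck_on k S (\<lambda>x. frechet_derivative (\<lambda>x. L (f x)) (at x) v)" for v
    by (rule Ck_on_cong[OF assms(1) _ Suc.IH[of "\<lambda>x. frechet_derivative f (at x) v"]])
      (use Suc.prems frechet_derivative_at[OF der] in \<open>auto simp: fun_eq_iff\<close>)
  then show ?case using der by (auto simp: differentiable_def)
qed

lemma Ck_on_comp_affine:
  assumes "open T" and L: "bounded_linear L" and "Ck_on k S f"
    and "\<And>s. s \<in> T \<Longrightarrow> c + L s \<in> S"
  shows "Ck_on k T (\<lambda>s. f (c + L s))"
  using assms(3)
proof (induction k arbitrary: f)
  case 0
  have "continuous_on T (\<lambda>s. c + L s)"
    by (intro continuous_intros bounded_linear.continuous_on[OF L])
  with 0 show ?case
    using assms(4) by (auto intro: continuous_on_compose2)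
next
  case (Suc k)
  have der: "((\<lambda>s. f (c + L s)) has_derivative
      (\<lambda>v. frechet_derivative f (at (c + L s)) (L v))) (at s)" if "s \<in> T" for s
  proof -
    have "((\<lambda>s. c + L s) has_derivative L) (at s)"
      using bounded_linear_imp_has_derivative[OF L] by (auto intro!: derivative_eq_intros)
    moreover have "(f has_derivative frechet_derivative f (at (c + L s))) (at (c + L s))"
      using Suc.prems assms(4)[OF that] frechet_derivative_works by auto
    ultimately show ?thesis
      using diff_chain_at[of "\<lambda>s. c + L s" L s f] by (simp add: o_def)
  qed
  have "Ck_on k T (\<lambda>s. frechet_derivative (\<lambda>s. f (c + L s)) (at s) v)" for v
    by (rule Ck_on_cong[OF assms(1) _ Suc.IH[of "\<lambda>x. frechet_derivative f (at x) (L v)"]])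
      (use Suc.prems frechet_derivative_at[OF der] in \<open>auto simp: fun_eq_iff\<close>)
  then show ?case using der by (auto simp: differentiable_def)
qed

lemma smooth_on_imp_has_derivative:
  assumes "smooth_on S f" and "x \<in> S"
  shows "(f has_derivative frechet_derivative f (at x)) (at x)"
  using assms frechet_derivative_works unfolding smooth_on_def by (metis Ck_on.simps(2))

lemma smooth_on_directional_derivative:
  assumes "smooth_on S f"
  shows "smooth_on S (\<lambda>x. frechet_derivative f (at x) v)"
  using assms unfolding smooth_on_def by (metis Ck_on.simps(2))

section \<open>Web transformations and diagonal derivatives\<close>

definition diagonal_derivative :: "(real ^ 'm \<Rightarrow> real ^ 'm) \<Rightarrow> real ^ 'm \<Rightarrow> bool"
  where "diagonal_derivative \<Phi> p \<longleftrightarrow>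
    (\<exists>c. \<forall>v k. frechet_derivative \<Phi> (at p) v $ k = c k * v $ k)"

lemma diagonal_derivative_entries:
  fixes \<Phi> :: "real ^ ('m::finite) \<Rightarrow> real ^ 'm"
  assumes "diagonal_derivative \<Phi> p"
  shows "frechet_derivative \<Phi> (at p) v $ k
    = frechet_derivative \<Phi> (at p) (axis k 1) $ k * v $ k"
  using assms unfolding diagonal_derivative_def by (auto simp: axis_def)

lemma componentwise_imp_diagonal_derivative:
  fixes \<Phi> :: "real ^ ('m::finite) \<Rightarrow> real ^ 'm"
  assumes "open N" and "p \<in> N"
    and \<Phi>: "(\<Phi> has_derivative frechet_derivative \<Phi> (at p)) (at p)"
    and \<phi>: "\<And>k. \<phi> k differentiable (at (p $ k))"
    and eq: "\<And>q. q \<in> N \<Longrightarrow> \<Phi> q = (\<chi> k. \<phi> k (q $ k))"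
  shows "diagonal_derivative \<Phi> p"
  unfolding diagonal_derivative_def
proof (intro exI allI)
  fix v k
  let ?d = "frechet_derivative (\<phi> k) (at (p $ k))"
  have d: "(\<phi> k has_derivative ?d) (at (p $ k))"
    using \<phi> frechet_derivative_works by blast
  have nth: "((\<lambda>q. q $ k) has_derivative (\<lambda>v. v $ k)) (at p)"
    by (rule bounded_linear_imp_has_derivative[OF bounded_linear_vec_nth])
  have "((\<lambda>q. \<phi> k (q $ k)) has_derivative (\<lambda>v. ?d (v $ k))) (at p)"
    using diff_chain_at[OF nth d] by (simp add: o_def)
  moreover have "((\<lambda>q. \<phi> k (q $ k)) has_derivative
      (\<lambda>v. frechet_derivative \<Phi> (at p) v $ k)) (at p)"
    by (rule has_derivative_transform_within_open[OF
          bounded_linear.has_derivative[OF bounded_linear_vec_nth \<Phi>] assms(1,2)])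
      (simp add: eq)
  ultimately have "frechet_derivative \<Phi> (at p) v $ k = ?d (v $ k)"
    by (metis has_derivative_unique)
  also have "\<dots> = ?d 1 * v $ k"
    using linear_cmul[OF has_derivative_linear[OF d], of "v $ k" 1] by simp
  finally show "frechet_derivative \<Phi> (at p) v $ k
    = (\<lambda>k. frechet_derivative (\<phi> k) (at (p $ k)) 1) k * v $ k" .
qed

text \<open>
  The derivative of the \<open>k\<close>-th component along the segment from \<open>q\<close> to \<open>r\<close> is a multiple
  of the vanishing \<open>k\<close>-th coordinate of \<open>r - q\<close>.
\<close>

lemma diagonal_derivative_imp_component_eq:
  fixes \<Phi> :: "real ^ ('m::finite) \<Rightarrow> real ^ 'm"
  assumes "convex N" and "q \<in> N" and "r \<in> N" and "q $ k = r $ k"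
    and \<Phi>: "\<And>p. p \<in> N \<Longrightarrow> (\<Phi> has_derivative frechet_derivative \<Phi> (at p)) (at p)"
    and diag: "\<And>p. p \<in> N \<Longrightarrow> diagonal_derivative \<Phi> p"
  shows "\<Phi> q $ k = \<Phi> r $ k"
proof -
  let ?\<gamma> = "\<lambda>s::real. q + s *\<^sub>R (r - q)"
  let ?D = "\<lambda>s. frechet_derivative \<Phi> (at (?\<gamma> s))"
  have mem: "?\<gamma> s \<in> N" if "s \<in> {0..1}" for s
  proof -
    have "?\<gamma> s = (1 - s) *\<^sub>R q + s *\<^sub>R r" by (simp add: algebra_simps)
    then show ?thesis using assms(1-3) that by (simp add: convexD_alt)
  qed
  have der: "((\<lambda>s. \<Phi> (?\<gamma> s) $ k) has_derivative (\<lambda>h. ?D s (h *\<^sub>R (r - q)) $ k))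
      (at s within {0..1})" if "s \<in> {0..1}" for s
  proof -
    have "(?\<gamma> has_derivative (\<lambda>h. h *\<^sub>R (r - q))) (at s)"
      by (auto intro!: derivative_eq_intros)
    from diff_chain_at[OF this \<Phi>[OF mem[OF that]]]
    have "((\<lambda>s. \<Phi> (?\<gamma> s)) has_derivative (\<lambda>h. ?D s (h *\<^sub>R (r - q)))) (at s)"
      by (simp add: o_def)
    from bounded_linear.has_derivative[OF bounded_linear_vec_nth this]
    show ?thesis by (rule has_derivative_at_withinI)
  qed
  obtain s where s: "s \<in> {0..1}"
    and "\<Phi> (?\<gamma> 1) $ k - \<Phi> (?\<gamma> 0) $ k = ?D s ((1 - 0) *\<^sub>R (r - q)) $ k"
    using mvt_very_simple[OF zero_le_one der] by auto
  moreover have "?D s (r - q) $ k = 0"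
    using diagonal_derivative_entries[OF diag[OF mem[OF s]], of "r - q" k] assms(4) by simp
  ultimately show ?thesis by simp
qed

lemma diagonal_derivative_imp_local_form:
  fixes \<Phi> :: "real ^ ('m::finite) \<Rightarrow> real ^ 'm"
  assumes "open U" and "smooth_on U \<Phi>" and "p \<in> U"
    and diag: "\<And>q. q \<in> U \<Longrightarrow> diagonal_derivative \<Phi> q"
  shows "\<exists>N (\<phi> :: 'm \<Rightarrow> real \<Rightarrow> real). open N \<and> p \<in> N \<and> N \<subseteq> U \<and>
    (\<forall>k. smooth_on ((\<lambda>q. q $ k) ` N) (\<phi> k)) \<and> (\<forall>q\<in>N. \<Phi> q = (\<chi> k. \<phi> k (q $ k)))"
proof -
  obtain a b where p: "p \<in> box a b" and sub: "box a b \<subseteq> U"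
    using assms(1,3) by (metis open_contains_box)
  define line where "line k s = (p - (p $ k) *\<^sub>R axis k 1) + s *\<^sub>R axis k 1" for k s
  have line_nth: "line k s $ j = (if j = k then s else p $ j)" for k s j
    by (simp add: line_def axis_def)
  define \<phi> where "\<phi> k s = \<Phi> (line k s) $ k" for k s
  have line_box: "line k (q $ k) \<in> box a b" if "q \<in> box a b" for q k
    using that p by (auto simp: mem_box_cart line_nth)
  have "smooth_on ((\<lambda>q. q $ k) ` box a b) (\<phi> k)" for k
    unfolding smooth_on_def
  proof
    fix m
    \<comment> \<open>The coordinate projection of the box lies in this set, whose openness follows from continuity.\<close>
    let ?T = "line k -` U"
    have lin: "bounded_linear (\<lambda>s. s *\<^sub>R axis k (1::real))"
      by (rule bounded_linear_scaleR_left)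
    have "open ?T"
      unfolding line_def by (intro open_vimage assms(1) continuous_intros)
    moreover have "Ck_on m U \<Phi>"
      using assms(2) by (simp add: smooth_on_def)
    ultimately have "Ck_on m ?T (\<lambda>s. \<Phi> (line k s))"
      unfolding line_def by (intro Ck_on_comp_affine[OF _ lin]) auto
    then have "Ck_on m ?T (\<phi> k)"
      unfolding \<phi>_def by (intro Ck_on_linear_comp[OF \<open>open ?T\<close> bounded_linear_vec_nth])
    moreover have "(\<lambda>q. q $ k) ` box a b \<subseteq> ?T"
      using line_box sub by auto
    ultimately show "Ck_on m ((\<lambda>q. q $ k) ` box a b) (\<phi> k)"
      by (rule Ck_on_subset)
  qed
  moreover have "\<Phi> q = (\<chi> k. \<phi> k (q $ k))" if "q \<in> box a b" for q
  proof -
    have "\<Phi> q $ k = \<Phi> (line k (q $ k)) $ k" for k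
      by (rule diagonal_derivative_imp_component_eq[of "box a b"])
        (use that line_box sub diag smooth_on_imp_has_derivative[OF assms(2)]
          in \<open>auto simp: line_nth\<close>)
    then show ?thesis by (simp add: vec_eq_iff \<phi>_def)
  qed
  ultimately show ?thesis
    using p sub open_box by blast
qed

lemma web_transformation_iff_diagonal:
  fixes \<Phi> :: "real ^ ('n::finite) option \<Rightarrow> real ^ 'n option"
  assumes "open U" and diff: "diffeomorphism U V \<Phi>"
  shows "web_transformation U V \<Phi> \<longleftrightarrow> (\<forall>p\<in>U. diagonal_derivative \<Phi> p)"
proof
  have sm: "smooth_on U \<Phi>"
    using diff by (simp add: diffeomorphism_def)
  {
    assume web: "web_transformation U V \<Phi>"
    show "\<forall>p\<in>U. diagonal_derivative \<Phi> p"
    proof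
      fix p assume p: "p \<in> U"
      with web obtain N and \<phi> :: "'n option \<Rightarrow> real \<Rightarrow> real" where N: "open N" "p \<in> N"
        and \<phi>: "\<And>k. smooth_on ((\<lambda>q. q $ k) ` N) (\<phi> k)"
        and eq: "\<And>q. q \<in> N \<Longrightarrow> \<Phi> q = (\<chi> k. \<phi> k (q $ k))"
        unfolding web_transformation_def by meson
      have "\<phi> k differentiable (at (p $ k))" for k
        using smooth_on_imp_has_derivative[OF \<phi>] N(2) unfolding differentiable_def by blast
      with N eq show "diagonal_derivative \<Phi> p"
        using componentwise_imp_diagonal_derivative smooth_on_imp_has_derivative[OF sm p]
        by blast
    qed
  next
    assume "\<forall>p\<in>U. diagonal_derivative \<Phi> p"
    then show "web_transformation U V \<Phi>"
      unfolding web_transformation_def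
      using diff diagonal_derivative_imp_local_form[OF assms(1) sm] by blast
  }
qed

section \<open>The two multiplier equations at a point\<close>

definition diagonal_matrix :: "('m \<Rightarrow> real) \<Rightarrow> real ^ 'm ^ 'm"
  where "diagonal_matrix c = (\<chi> i j. if i = j then c i else 0)"

lemma diagonal_matrix_mult_vec:
  fixes c :: "'m::finite \<Rightarrow> real"
  shows "diagonal_matrix c *v v = (\<chi> i. c i * v $ i)"
  by (simp add: diagonal_matrix_def matrix_vector_mult_def vec_eq_iff if_distrib[of "\<lambda>x. x * _"]
      cong: if_cong)

lemma invertible_diagonal_matrix_iff:
  fixes c :: "'m::finite \<Rightarrow> real"
  shows "invertible (diagonal_matrix c) \<longleftrightarrow> (\<forall>i. c i \<noteq> 0)"
  by (subst invertible_det_nz, subst det_diagonal) (simp_all add: diagonal_matrix_def)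

lemma smooth_on_diagonal_matrix:
  fixes c :: "'m::finite \<Rightarrow> 'a::real_normed_vector \<Rightarrow> real"
  assumes "open S" and "\<And>i. smooth_on S (c i)"
  shows "smooth_on S (\<lambda>p. diagonal_matrix (\<lambda>i. c i p))"
  unfolding smooth_on_def
proof
  fix k
  have "Ck_on k S (\<lambda>p. \<Sum>i\<in>UNIV. c i p *\<^sub>R diagonal_matrix (\<lambda>j. if j = i then 1 else 0))"
    using assms(2) unfolding smooth_on_def
    by (intro Ck_on_sum Ck_on_linear_comp[OF assms(1) bounded_linear_scaleR_left] assms(1)) auto
  moreover have "(\<Sum>i\<in>UNIV. c i p *\<^sub>R diagonal_matrix (\<lambda>j. if j = i then 1 else 0))
      = diagonal_matrix (\<lambda>i. c i p)" for p
    by (simp add: vec_eq_iff diagonal_matrix_def if_distrib[of "\<lambda>x. _ * x"] cong: if_cong)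
  ultimately show "Ck_on k S (\<lambda>p. diagonal_matrix (\<lambda>i. c i p))" by simp
qed

lemma scalar_matrices_mult_vec:
  fixes M :: "real ^ ('m::finite) ^ 'm"
  assumes "M \<in> scalar_matrices"
  obtains a where "a \<noteq> 0" and "\<And>v. M *v v = a *\<^sub>R v"
  using assms unfolding scalar_matrices_def
  by (auto simp: scaleR_matrix_vector_assoc[symmetric])

lemma pullback_system_forms_nth:
  "pullback \<Phi> (system_forms F) p v $ i = frechet_derivative \<Phi> (at p) v $ Some i
    - F i (space_proj (\<Phi> p)) * frechet_derivative \<Phi> (at p) v $ None"
  by (simp add: pullback_def system_forms_def coord_differential_def)

lemma system_forms_nth:
  "system_forms f p v $ i = v $ Some i - f i (space_proj p) * v $ None"
  by (simp add: system_forms_def coord_differential_def)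

lemma pullback_system_coframe_nth:
  "pullback \<Phi> (system_coframe F) p v $ None = frechet_derivative \<Phi> (at p) v $ None"
  "pullback \<Phi> (system_coframe F) p v $ Some i
    = frechet_derivative \<Phi> (at p) v $ Some i / F i (space_proj (\<Phi> p))"
  by (simp_all add: pullback_def system_coframe_def coord_differential_def)

lemma system_coframe_nth:
  "system_coframe f p v $ None = v $ None"
  "system_coframe f p v $ Some i = v $ Some i / f i (space_proj p)"
  by (simp_all add: system_coframe_def coord_differential_def)

text \<open>
  The forms \<open>dx_j - f_j dt\<close> take the values of a standard basis vector on the coordinate vector
  of \<open>x_i\<close> and the values \<open>-f_j\<close> on that of \<open>t\<close>: the former determine the multiplier and
  the latter relate its entries to the derivative of the time component.
\<close>

lemma system_multiplier_of_diagonal_derivative: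
  fixes \<Phi> :: "real ^ ('n::finite) option \<Rightarrow> real ^ 'n option"
  assumes D: "\<And>v k. frechet_derivative \<Phi> (at p) v $ k = c k * v $ k"
    and A: "\<And>v. pullback \<Phi> (system_forms F) p v = A *v system_forms f p v"
  shows "A = diagonal_matrix (\<lambda>i. c (Some i))"
    and "c (Some i) * f i (space_proj p) = c None * F i (space_proj (\<Phi> p))"
proof -
  have "A *v axis j 1 = diagonal_matrix (\<lambda>i. c (Some i)) *v axis j 1" for j
  proof -
    have "system_forms f p (axis (Some j) 1) = axis j 1"
      by (simp add: vec_eq_iff system_forms_nth axis_def)
    then have "A *v axis j 1 = pullback \<Phi> (system_forms F) p (axis (Some j) 1)"
      using A[of "axis (Some j) 1"] by simp
    then show ?thesis
      by (simp add: vec_eq_iff pullback_system_forms_nth D diagonal_matrix_mult_vec axis_def)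
  qed
  then show A_eq: "A = diagonal_matrix (\<lambda>i. c (Some i))"
    by (simp add: vec_eq_iff matrix_vector_mult_basis column_def)
  show "c (Some i) * f i (space_proj p) = c None * F i (space_proj (\<Phi> p))"
    using arg_cong[OF A[of "axis None 1"], of "\<lambda>x. x $ i"]
    by (simp add: A_eq pullback_system_forms_nth D diagonal_matrix_mult_vec system_forms_nth
        axis_def mult.commute)
qed

section \<open>The equivalence\<close>

theorem mainTheorem1:
  fixes U V :: "(real ^ ('n::finite) option) set"
    and f F :: "'n \<Rightarrow> real ^ 'n \<Rightarrow> real"
    and \<Phi> :: "real ^ 'n option \<Rightarrow> real ^ 'n option"
  assumes "open U" and "open V"
    and "\<And>i. smooth_on (space_proj ` U) (f i)"
    and "\<And>i x. x \<in> space_proj ` U \<Longrightarrow> f i x \<noteq> 0"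
    and "\<And>i. smooth_on (space_proj ` V) (F i)"
    and "\<And>i X. X \<in> space_proj ` V \<Longrightarrow> F i X \<noteq> 0"
    and "diffeomorphism U V \<Phi>"
  shows "web_equivalence U f V F \<Phi> \<longleftrightarrow>
    (\<exists>g :: real ^ 'n option \<Rightarrow> real ^ 'n option ^ 'n option.
       smooth_on U g \<and> g ` U \<subseteq> scalar_matrices \<and>
       (\<forall>p\<in>U. \<forall>v. pullback \<Phi> (system_coframe F) p v = g p *v system_coframe f p v))"
    (is "_ \<longleftrightarrow> ?G")
proof -
  define c where "c k p = frechet_derivative \<Phi> (at p) (axis k 1) $ k" for k p
  have smooth_c: "smooth_on U (c k)" for k
  proof -
    have "smooth_on U (\<lambda>p. frechet_derivative \<Phi> (at p) (axis k 1))"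
      using assms(7) smooth_on_directional_derivative by (auto simp: diffeomorphism_def)
    then show ?thesis
      unfolding c_def smooth_on_def
      using Ck_on_linear_comp[OF assms(1) bounded_linear_vec_nth] by blast
  qed
  have f0: "f i (space_proj p) \<noteq> 0" and F0: "F i (space_proj (\<Phi> p)) \<noteq> 0" if "p \<in> U" for i p
    using that assms(4,6,7) by (auto simp: diffeomorphism_def bij_betw_def)
  show ?thesis
  proof
    assume web: "web_equivalence U f V F \<Phi>"
    then have D: "frechet_derivative \<Phi> (at p) v $ k = c k p * v $ k" if "p \<in> U" for p v k
      using that web_transformation_iff_diagonal[OF assms(1,7)] diagonal_derivative_entries
      unfolding web_equivalence_def c_def by blast
    from web obtain A where inv: "\<And>p. p \<in> U \<Longrightarrow> invertible (A p)"
      and A: "\<And>p v. p \<in> U \<Longrightarrow> pullback \<Phi> (system_forms F) p v = A p *v system_forms f p v"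
      unfolding web_equivalence_def maps_system_def by blast
    have A_eq: "A p = diagonal_matrix (\<lambda>i. c (Some i) p)"
      and rel: "c (Some i) p * f i (space_proj p) = c None p * F i (space_proj (\<Phi> p))"
      if "p \<in> U" for p i
      using system_multiplier_of_diagonal_derivative[of \<Phi> p "\<lambda>k. c k p" F "A p" f] D A that
      by auto
    have c0: "c None p \<noteq> 0" if "p \<in> U" for p
    proof
      assume "c None p = 0"
      then have "c (Some i) p = 0" for i
        using rel[OF that, of i] f0[OF that] by simp
      then show False
        using inv[OF that] by (simp add: A_eq[OF that] invertible_diagonal_matrix_iff)
    qed
    let ?g = "\<lambda>p. c None p *\<^sub>R (mat 1 :: real ^ 'n option ^ 'n option)"
    have "smooth_on U ?g"
      using smooth_c Ck_on_linear_comp[OF assms(1) bounded_linear_scaleR_left]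
      unfolding smooth_on_def by blast
    moreover have "?g ` U \<subseteq> scalar_matrices"
      using c0 by (auto simp: scalar_matrices_def)
    moreover have "pullback \<Phi> (system_coframe F) p v = ?g p *v system_coframe f p v"
      if "p \<in> U" for p v
    proof -
      have "pullback \<Phi> (system_coframe F) p v $ k = c None p * system_coframe f p v $ k" for k
      proof (cases k)
        case None
        then show ?thesis
          by (simp add: pullback_system_coframe_nth system_coframe_nth D[OF that])
      next
        case (Some i)
        have "c (Some i) p / F i (space_proj (\<Phi> p)) = c None p / f i (space_proj p)"
          using rel[OF that, of i] f0[OF that] F0[OF that] by (simp add: field_simps)
        then show ?thesis
          by (simp add: Some pullback_system_coframe_nth system_coframe_nth D[OF that])
            (metis times_divide_eq_left mult.commute)
      qed
      then show ?thesis
        by (simp add: vec_eq_iff scaleR_matrix_vector_assoc[symmetric])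
    qed
    ultimately show ?G by blast
  next
    assume ?G
    then obtain g :: "real ^ 'n option \<Rightarrow> real ^ 'n option ^ 'n option" where
      scal: "\<And>p. p \<in> U \<Longrightarrow> g p \<in> scalar_matrices"
      and g: "\<And>p v. p \<in> U \<Longrightarrow> pullback \<Phi> (system_coframe F) p v = g p *v system_coframe f p v"
      by blast
    have "\<exists>a. \<forall>p\<in>U. a p \<noteq> 0 \<and> (\<forall>v. g p *v v = a p *\<^sub>R v)"
      by (rule bchoice) (metis scal scalar_matrices_mult_vec)
    then obtain a where a0: "\<And>p. p \<in> U \<Longrightarrow> a p \<noteq> 0"
      and a: "\<And>p v. p \<in> U \<Longrightarrow> g p *v v = a p *\<^sub>R v"
      by blast
    let ?b = "\<lambda>p i. a p * F i (space_proj (\<Phi> p)) / f i (space_proj p)"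
    have D_None: "frechet_derivative \<Phi> (at p) v $ None = a p * v $ None" if "p \<in> U" for p v
      using arg_cong[OF g[OF that, of v], of "\<lambda>x. x $ None"]
      by (simp add: pullback_system_coframe_nth system_coframe_nth a[OF that])
    have D_Some: "frechet_derivative \<Phi> (at p) v $ Some i = ?b p i * v $ Some i"
      if "p \<in> U" for p v i
      using arg_cong[OF g[OF that, of v], of "\<lambda>x. x $ Some i"] f0[OF that, of i] F0[OF that, of i]
      by (simp add: pullback_system_coframe_nth system_coframe_nth a[OF that] field_simps)
    have c_Some: "c (Some i) p = ?b p i" if "p \<in> U" for i p
      by (simp add: c_def D_Some[OF that])
    have "diagonal_derivative \<Phi> p" if "p \<in> U" for p
      unfolding diagonal_derivative_def
      by (rule exI[of _ "case_option (a p) (?b p)"])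
        (auto simp: D_None[OF that] D_Some[OF that] split: option.split)
    then have "web_transformation U V \<Phi>"
      using web_transformation_iff_diagonal[OF assms(1,7)] by blast
    moreover have "maps_system U f V F \<Phi>"
      unfolding maps_system_def
    proof (intro conjI assms(7) exI ballI allI)
      let ?A = "\<lambda>p. diagonal_matrix (\<lambda>i. c (Some i) p)"
      show "smooth_on U ?A"
        by (rule smooth_on_diagonal_matrix[OF assms(1) smooth_c])
      fix p assume p: "p \<in> U"
      show "invertible (?A p)"
        using a0[OF p] f0[OF p] F0[OF p] by (simp add: invertible_diagonal_matrix_iff c_Some[OF p])
      fix v
      show "pullback \<Phi> (system_forms F) p v = ?A p *v system_forms f p v"
        using f0[OF p]
        by (simp add: vec_eq_iff diagonal_matrix_mult_vec pullback_system_forms_nth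
            system_forms_nth D_None[OF p] D_Some[OF p] c_Some[OF p] field_simps)
    qed
    ultimately show "web_equivalence U f V F \<Phi>"
      by (simp add: web_equivalence_def)
  qed
qed

end
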